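(* The skew Schur function $s_D$ of a skew diagram $D$ determines the row overlap partitions $(\rho^{(k)})_{k\ge1}$ of $D$. Consequently, if $D\sim D'$, then $D$ and $D'$ have the same row overlap partitions $\rho^{(k)}$ for every $k\geq 1$.
   Context: A skew diagram $D=\lambda/\mu$ ($\mu\subseteq\lambda$ partitions, English notation) is the set of cells of $\lambda$ not in $\mu$, considered up to translation and insertion/removal of empty rows or columns. $s_D=\sum_Tx^T$ over column-strict fillings of $D$ by positive integers (rows weakly increasing, columns strictly increasing downward) is the skew Schur function; $D\sim D'$ means $s_D=s_{D'}$. If $D$ occupies $r$ rows, then for $1\le k\le r$ the $k$-row overlap composition $r^{(k)}=(r^{(k)}_1,\dots,r^{(k)}_{r-k+1})$ has $r^{(k)}_i$ equal to the number of columns occupied in common by the rows $i,i+1,\dots,i+k-1$ of $D$. The $k$-row overlap partition $\rho^{(k)}$ is the weakly decreasing rearrangement of $r^{(k)}$ (zero parts being disregarded; $\rho^{(k)}$ is empty for $k>r$). *)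

theory Defs
  imports Main "HOL-Library.Poly_Mapping"
begin

type_synonym cell = "nat \<times> nat"

definition is_partition :: "nat list \<Rightarrow> bool" where
  "is_partition xs \<longleftrightarrow> sorted_wrt (\<ge>) xs \<and> (\<forall>x \<in> set xs. 0 < x)"

text \<open>
  Cells are pairs (row, column), both counted from 0, with rows numbered downwards
  (English notation).
\<close>

definition diagram :: "nat list \<Rightarrow> cell set" where
  "diagram lam = {(i, j). i < length lam \<and> j < lam ! i}"

text \<open>
  Skew diagrams are represented by their cell sets. No representative is singled out: all the
  sets \<open>\<lambda>/\<mu>\<close> that differ by translation or by empty rows and columns are admitted.
\<close>

definition skew_diagram :: "cell set \<Rightarrow> bool" where
  "skew_diagram D \<longleftrightarrow>
     (\<exists>lam mu. is_partition lam \<and> is_partition mu \<and> diagram mu \<subseteq> diagram lam \<and>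
        D = diagram lam - diagram mu)"

text \<open>
  The value 0 outside \<open>D\<close> is a convention which makes a filling of \<open>D\<close> a unique function.
\<close>

definition column_strict_filling :: "cell set \<Rightarrow> (cell \<Rightarrow> nat) \<Rightarrow> bool" where
  "column_strict_filling D T \<longleftrightarrow>
     (\<forall>c \<in> D. 1 \<le> T c) \<and>
     (\<forall>c. c \<notin> D \<longrightarrow> T c = 0) \<and>
     (\<forall>i j j'. (i, j) \<in> D \<longrightarrow> (i, j') \<in> D \<longrightarrow> j < j' \<longrightarrow> T (i, j) \<le> T (i, j')) \<and>
     (\<forall>i i' j. (i, j) \<in> D \<longrightarrow> (i', j) \<in> D \<longrightarrow> i < i' \<longrightarrow> T (i, j) < T (i', j))"

text \<open>
  A monomial in \<open>x\<^sub>1, x\<^sub>2, \<dots>\<close> is its finitely supported exponent function, so the product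
  \<open>x\<^sup>T = (\<Prod>c\<in>D. x\<^bsub>T c\<^esub>)\<close> becomes a sum of exponents.
\<close>

definition filling_monomial :: "cell set \<Rightarrow> (cell \<Rightarrow> nat) \<Rightarrow> (nat \<Rightarrow>\<^sub>0 nat)" where
  "filling_monomial D T = (\<Sum>c \<in> D. Poly_Mapping.single (T c) 1)"

text \<open>
  A formal power series with integer coefficients in infinitely many variables is its
  coefficient function on monomials. In \<open>s\<^sub>D = (\<Sum>T. x\<^sup>T)\<close> the coefficient of \<open>m\<close> is the number
  of fillings \<open>T\<close> with \<open>x\<^sup>T = m\<close>; see \<open>finite_fillings\<close> below for finiteness.
\<close>

definition skew_schur :: "cell set \<Rightarrow> (nat \<Rightarrow>\<^sub>0 nat) \<Rightarrow> int" where
  "skew_schur D m = int (card {T. column_strict_filling D T \<and> filling_monomial D T = m})"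

definition skew_equiv :: "cell set \<Rightarrow> cell set \<Rightarrow> bool" (infix "\<sim>\<^sub>s" 50) where
  "D \<sim>\<^sub>s D' \<longleftrightarrow> skew_schur D = skew_schur D'"

text \<open>
  The nonempty rows of \<open>D\<close> from top to bottom: empty rows are removed before overlaps are taken.
\<close>

definition occupied_rows :: "cell set \<Rightarrow> nat list" where
  "occupied_rows D = sorted_list_of_set (fst ` D)"

text \<open>
  Meaningful for \<open>k \<ge> 1\<close>. With \<open>r\<close> occupied rows the list has \<open>r - k + 1\<close> entries if \<open>k \<le> r\<close>,
  and is empty (truncated subtraction) if \<open>k > r\<close>.
\<close>

definition row_overlap_composition :: "nat \<Rightarrow> cell set \<Rightarrow> nat list" where
  "row_overlap_composition k D =
     (let rs = occupied_rows D in
      map (\<lambda>i. card {c. \<forall>t \<in> {i..<i + k}. (rs ! t, c) \<in> D}) [0..<length rs + 1 - k])"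

definition row_overlap_partition :: "nat \<Rightarrow> cell set \<Rightarrow> nat list" where
  "row_overlap_partition k D =
     rev (sort (filter (\<lambda>a. a \<noteq> 0) (row_overlap_composition k D)))"

lemma finite_skew_diagram:
  assumes "skew_diagram D"
  shows "finite D"
proof -
  have "finite (diagram lam)" for lam
  proof -
    have "diagram lam = (SIGMA i:{..<length lam}. {..<lam ! i})"
      by (auto simp: diagram_def)
    then show ?thesis by simp
  qed
  with assms show ?thesis by (auto simp: skew_diagram_def)
qed

lemma finite_fillings:
  assumes "skew_diagram D"
  shows "finite {T. column_strict_filling D T \<and> filling_monomial D T = m}"
proof (rule finite_subset)
  have fin: "finite D" using assms by (rule finite_skew_diagram)
  show "finite {T. \<forall>c. (c \<in> D \<longrightarrow> T c \<in> Poly_Mapping.keys m) \<and> (c \<notin> D \<longrightarrow> T c = 0)}"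
    by (rule finite_set_of_finite_funs) (use fin in auto)
  have "T c \<in> Poly_Mapping.keys (filling_monomial D T)" if "c \<in> D" for T c
  proof -
    have "Poly_Mapping.lookup (filling_monomial D T) (T c)
        = (\<Sum>d \<in> D. Poly_Mapping.lookup (Poly_Mapping.single (T d) (1::nat)) (T c))"
      by (simp add: filling_monomial_def Poly_Mapping.lookup_sum)
    also have "\<dots> \<noteq> 0"
      using fin that by (auto simp: Poly_Mapping.lookup_single when_def)
    finally show ?thesis by (simp add: in_keys_iff)
  qed
  then show "{T. column_strict_filling D T \<and> filling_monomial D T = m}
      \<subseteq> {T. \<forall>c. (c \<in> D \<longrightarrow> T c \<in> Poly_Mapping.keys m) \<and> (c \<notin> D \<longrightarrow> T c = 0)}"
    by (auto simp: column_strict_filling_def)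
qed

end

theory Submission
  imports Defs "HOL-Library.Multiset"
begin

text \<open>
  A filling of \<open>D\<close> is a chain of order ideals of \<open>D\<close> whose successive differences are horizontal
  strips, so \<open>s\<^sub>D\<close> records the numbers of such chains with prescribed strip sizes. The relation
  \<open>\<Sum>\<^sub>i (-1)\<^sup>i h\<^bsub>k-i\<^esub> e\<^sub>i = 0\<close>, realised by a sign-reversing involution on pairs of strips, expresses
  chains containing vertical strips through chains of horizontal ones. Hence \<open>s\<^sub>D\<close> determines the
  numbers of nonempty rows and columns, which are the maximal sizes of a vertical and of a
  horizontal strip. A strip of maximal size is unique: it consists of the first cells of all rows
  (or columns). So the mixed chain counts of \<open>D\<close> determine those of \<open>D\<close> with these cells removed,
  and one can iterate. Removing the top cell of every column \<open>k - 1\<close> times and then the leftmost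
  cell of every row \<open>l - 1\<close> times leaves as many nonempty rows as \<open>\<rho>\<^sup>(\<^sup>k\<^sup>)\<close> has parts \<open>\<ge> l\<close>.
\<close>

section \<open>Order ideals, strips and chain counts\<close>

definition order_ideal :: "cell set \<Rightarrow> cell set \<Rightarrow> bool" where
  "order_ideal D S \<longleftrightarrow> S \<subseteq> D \<and>
     (\<forall>i j j'. (i, j) \<in> S \<longrightarrow> (i, j') \<in> D \<longrightarrow> j' < j \<longrightarrow> (i, j') \<in> S) \<and>
     (\<forall>i i' j. (i, j) \<in> S \<longrightarrow> (i', j) \<in> D \<longrightarrow> i' < i \<longrightarrow> (i', j) \<in> S)"

lemma order_idealI:
  assumes "S \<subseteq> D"
    and "\<And>i j j'. (i, j) \<in> S \<Longrightarrow> (i, j') \<in> D \<Longrightarrow> j' < j \<Longrightarrow> (i, j') \<in> S"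
    and "\<And>i i' j. (i, j) \<in> S \<Longrightarrow> (i', j) \<in> D \<Longrightarrow> i' < i \<Longrightarrow> (i', j) \<in> S"
  shows "order_ideal D S"
  using assms unfolding order_ideal_def by blast

lemma order_idealD:
  assumes "order_ideal D S"
  shows "S \<subseteq> D"
    and "\<And>i j j'. (i, j) \<in> S \<Longrightarrow> (i, j') \<in> D \<Longrightarrow> j' < j \<Longrightarrow> (i, j') \<in> S"
    and "\<And>i i' j. (i, j) \<in> S \<Longrightarrow> (i', j) \<in> D \<Longrightarrow> i' < i \<Longrightarrow> (i', j) \<in> S"
  using assms unfolding order_ideal_def by blast+

datatype letter = Hor nat | Ver nat

fun strips :: "letter \<Rightarrow> cell set \<Rightarrow> cell set set" where
  "strips (Hor a) D = {S. order_ideal D S \<and> inj_on snd S \<and> card S = a}"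
| "strips (Ver a) D = {S. order_ideal D S \<and> inj_on fst S \<and> card S = a}"

text \<open>\<open>Hor a\<close> stands for the complete symmetric function h_a and
  \<open>Ver a\<close> for the elementary one e_a. For a skew diagram,
  \<open>chain_count w D\<close> is the scalar product of s_D with the product of the functions
  named by the letters of \<open>w\<close>.\<close>

fun chain_count :: "letter list \<Rightarrow> cell set \<Rightarrow> int" where
  "chain_count [] D = (if D = {} then 1 else 0)"
| "chain_count (x # w) D = (\<Sum>S\<in>strips x D. chain_count w (D - S))"

lemma strips_subset: "S \<in> strips x D \<Longrightarrow> S \<subseteq> D"
  by (cases x) (auto simp: order_ideal_def)

lemma finite_strips: "finite D \<Longrightarrow> finite (strips x D)"
  by (rule finite_subset[of _ "Pow D"]) (auto dest: strips_subset)

lemma strips_0: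
  assumes "finite D"
  shows "strips (Hor 0) D = {{}}" "strips (Ver 0) D = {{}}"
proof -
  have "card S = 0 \<longleftrightarrow> S = {}" if "order_ideal D S" for S
    using finite_subset[OF order_idealD(1)[OF that] assms] by simp
  moreover have "order_ideal D {}" by (simp add: order_ideal_def)
  ultimately have "order_ideal D S \<and> inj_on f S \<and> card S = 0 \<longleftrightarrow> S = {}"
    for S and f :: "cell \<Rightarrow> nat"
    by (metis inj_on_empty)
  then show "strips (Hor 0) D = {{}}" "strips (Ver 0) D = {{}}"
    by simp_all
qed

lemma chain_count_nonneg: "0 \<le> chain_count w D"
  by (induction w arbitrary: D) (auto intro: sum_nonneg)

lemma chain_count_Cons_pos_iff:
  assumes "finite D"
  shows "0 < chain_count (x # w) D \<longleftrightarrow> (\<exists>S\<in>strips x D. 0 < chain_count w (D - S))"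
proof -
  have "0 < chain_count (x # w) D \<longleftrightarrow> chain_count (x # w) D \<noteq> 0"
    using chain_count_nonneg[of "x # w" D] by linarith
  also have "\<dots> \<longleftrightarrow> (\<exists>S\<in>strips x D. chain_count w (D - S) \<noteq> 0)"
    by (simp add: sum_nonneg_eq_0_iff finite_strips assms chain_count_nonneg)
  also have "\<dots> \<longleftrightarrow> (\<exists>S\<in>strips x D. 0 < chain_count w (D - S))"
    by (metis chain_count_nonneg less_irrefl order_le_less)
  finally show ?thesis .
qed

text \<open>The leftmost cell of the top row is a strip by itself, so the cells can be removed one
  at a time. The purpose is to ensure that whatever is left after removing a strip is seen by at
  least one word.\<close>

lemma ex_chain_count_pos:
  assumes "finite D"
  shows "\<exists>w. 0 < chain_count w D"
  using assms
proof (induction "card D" arbitrary: D)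
  case 0
  then have "0 < chain_count [] D" by simp
  then show ?case by blast
next
  case (Suc n)
  define i where "i = Min (fst ` D)"
  define j where "j = Min {j. (i, j) \<in> D}"
  have ne: "D \<noteq> {}" using Suc.hyps by auto
  have i_le: "i \<le> a" if "(a, b) \<in> D" for a b
    unfolding i_def using that Suc.prems by (intro Min_le) force+
  have "i \<in> fst ` D" unfolding i_def using ne Suc.prems by (intro Min_in) auto
  then have ne': "{j. (i, j) \<in> D} \<noteq> {}" by auto
  have fin': "finite {j. (i, j) \<in> D}"
    by (rule finite_subset[of _ "snd ` D"]) (use Suc.prems in force)+
  have ij: "(i, j) \<in> D" using Min_in[OF fin' ne'] by (simp add: j_def)
  have j_le: "j \<le> b" if "(i, b) \<in> D" for b
    unfolding j_def using that fin' by (intro Min_le) auto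
  have S: "{(i, j)} \<in> strips (Hor 1) D"
    using ij i_le j_le by (fastforce simp: order_ideal_def)
  have "card (D - {(i, j)}) = n"
    using Suc ij by simp
  with Suc obtain w where "0 < chain_count w (D - {(i, j)})" by blast
  with S Suc.prems have "0 < chain_count (Hor 1 # w) D"
    by (subst chain_count_Cons_pos_iff) auto
  then show ?case by blast
qed

section \<open>Horizontal strips determine vertical strips\<close>

lemma ex_corner:
  fixes U :: "cell set"
  assumes "finite U" "U \<noteq> {}"
  shows "\<exists>i j. (i, j) \<in> U \<and> (\<forall>j'. (i, j') \<in> U \<longrightarrow> j' \<le> j) \<and> (\<forall>i'. (i', j) \<in> U \<longrightarrow> i \<le> i')"
proof -
  define i where "i = Min (fst ` U)"
  define j where "j = Max {j. (i, j) \<in> U}"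
  have i_le: "i \<le> a" if "(a, b) \<in> U" for a b
    unfolding i_def using that assms by (intro Min_le) force+
  have "i \<in> fst ` U" unfolding i_def using assms by (intro Min_in) auto
  then have ne': "{j. (i, j) \<in> U} \<noteq> {}" by auto
  have fin': "finite {j. (i, j) \<in> U}"
    by (rule finite_subset[of _ "snd ` U"]) (use assms in force)+
  have ij: "(i, j) \<in> U" using Max_in[OF fin' ne'] by (simp add: j_def)
  have "b \<le> j" if "(i, b) \<in> U" for b
    unfolding j_def using that fin' by (intro Max_ge) auto
  with ij i_le show ?thesis by blast
qed

text \<open>The choice depends on \<open>U\<close> alone. Toggling keeps the union of the two
  strips, so a second toggle finds the same corner and undoes the first.\<close>

definition corner :: "cell set \<Rightarrow> cell" where
  "corner U = (SOME c. c \<in> U \<and> (\<forall>j'. (fst c, j') \<in> U \<longrightarrow> j' \<le> snd c) \<and>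
                        (\<forall>i'. (i', snd c) \<in> U \<longrightarrow> fst c \<le> i'))"

lemma corner:
  assumes "finite U" "U \<noteq> {}"
  shows "corner U \<in> U"
    and "\<And>j'. (fst (corner U), j') \<in> U \<Longrightarrow> j' \<le> snd (corner U)"
    and "\<And>i'. (i', snd (corner U)) \<in> U \<Longrightarrow> fst (corner U) \<le> i'"
proof -
  have "\<exists>c. c \<in> U \<and> (\<forall>j'. (fst c, j') \<in> U \<longrightarrow> j' \<le> snd c) \<and>
            (\<forall>i'. (i', snd c) \<in> U \<longrightarrow> fst c \<le> i')"
    using ex_corner[OF assms] by auto
  from someI_ex[OF this, folded corner_def] show "corner U \<in> U"
    and "\<And>j'. (fst (corner U), j') \<in> U \<Longrightarrow> j' \<le> snd (corner U)"
    and "\<And>i'. (i', snd (corner U)) \<in> U \<Longrightarrow> fst (corner U) \<le> i'"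
    by blast+
qed

definition strip_pairs :: "cell set \<Rightarrow> (cell set \<times> cell set) set" where
  "strip_pairs D = {(S, V). order_ideal D S \<and> inj_on snd S \<and>
                            order_ideal (D - S) V \<and> inj_on fst V}"

text \<open>The corner of \<open>S \<union> V\<close> has no other cell of \<open>S \<union> V\<close> above it or to its right, so it can belong
  to either strip.\<close>

definition toggle :: "cell set \<times> cell set \<Rightarrow> cell set \<times> cell set" where
  "toggle = (\<lambda>(S, V). let c = corner (S \<union> V) in
     if c \<in> S then (S - {c}, insert c V) else (insert c S, V - {c}))"

text \<open>Let c be the corner. If c is in \<open>S\<close>, then \<open>S\<close> has no cell to
  its right and no other cell in its column, so \<open>S\<close> stays an ideal without c; the cells
  of \<open>D\<close> to the left of c are all in \<open>S\<close>, so \<open>V\<close> has no cell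
  in that row and can receive c. If c is in \<open>V\<close>, the cells of \<open>D\<close> to its
  left are in \<open>S\<close>, because \<open>V\<close> has one cell per row, and a cell of
  \<open>D\<close> above c would be in the union, which the corner excludes; a cell of
  \<open>S\<close> below c would force c into \<open>S\<close>. So \<open>S\<close> can receive
  c.\<close>

lemma toggle_strip_pairs:
  assumes "finite D" and SV: "(S, V) \<in> strip_pairs D" and ne: "S \<union> V \<noteq> {}"
  shows "toggle (S, V) \<in> strip_pairs D"
proof -
  obtain i j where c: "corner (S \<union> V) = (i, j)" by fastforce
  from SV have S: "order_ideal D S" "inj_on snd S" and V: "order_ideal (D - S) V" "inj_on fst V"
    by (auto simp: strip_pairs_def)
  note S_ideal = order_idealD[OF S(1)]
  note V_ideal = order_idealD[OF V(1)]
  have "finite (S \<union> V)"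
    using S_ideal(1) V_ideal(1) \<open>finite D\<close> by (auto dest: finite_subset)
  note corner = corner[OF this ne, unfolded c, simplified]
  have S_col: "a = b" if "(a, m) \<in> S" "(b, m) \<in> S" for a b m
    using inj_onD[OF S(2), of "(a, m)" "(b, m)"] that by simp
  have V_row: "a = b" if "(m, a) \<in> V" "(m, b) \<in> V" for a b m
    using inj_onD[OF V(2), of "(m, a)" "(m, b)"] that by simp
  show ?thesis
  proof (cases "(i, j) \<in> S")
    case True
    have "order_ideal D (S - {(i, j)})"
    proof (rule order_idealI)
      show "S - {(i, j)} \<subseteq> D" using S_ideal(1) by blast
    next
      fix a b b' assume "(a, b) \<in> S - {(i, j)}" "(a, b') \<in> D" "b' < b"
      with S_ideal(2)[of a b b'] corner(2)[of b] show "(a, b') \<in> S - {(i, j)}" by force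
    next
      fix a a' b assume "(a, b) \<in> S - {(i, j)}" "(a', b) \<in> D" "a' < a"
      with S_ideal(3)[of a b a'] S_col[of a j i] True show "(a', b) \<in> S - {(i, j)}" by force
    qed
    moreover have "order_ideal (D - (S - {(i, j)})) (insert (i, j) V)"
    proof (rule order_idealI)
      show "insert (i, j) V \<subseteq> D - (S - {(i, j)})" using S_ideal(1) V_ideal(1) True by blast
    next
      fix a b b' assume "(a, b) \<in> insert (i, j) V" "(a, b') \<in> D - (S - {(i, j)})" "b' < b"
      with S_ideal(2)[of i j b'] V_ideal(2)[of a b b'] True
      show "(a, b') \<in> insert (i, j) V" by blast
    next
      fix a a' b assume "(a, b) \<in> insert (i, j) V" "(a', b) \<in> D - (S - {(i, j)})" "a' < a"
      with S_ideal(3)[of i j a'] V_ideal(3)[of a b a'] True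
      show "(a', b) \<in> insert (i, j) V" by blast
    qed
    moreover have "inj_on fst (insert (i, j) V)"
    proof -
      have "(i, b) \<notin> V" for b
        using corner(2)[of b] S_ideal(2)[of i j b] V_ideal(1) True
        by (cases b j rule: linorder_cases) auto
      with V(2) show ?thesis by (auto simp: inj_on_insert)
    qed
    moreover have "inj_on snd (S - {(i, j)})" using S(2) by (rule inj_on_subset) blast
    ultimately show ?thesis using True by (simp add: toggle_def c strip_pairs_def Let_def)
  next
    case False
    then have True: "(i, j) \<in> V" using corner(1) by blast
    have "order_ideal D (insert (i, j) S)"
    proof (rule order_idealI)
      show "insert (i, j) S \<subseteq> D" using S_ideal(1) V_ideal(1) True by blast
    next
      fix a b b' assume "(a, b) \<in> insert (i, j) S" "(a, b') \<in> D" "b' < b"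
      with S_ideal(2)[of a b b'] V_ideal(2)[of i j b'] V_row[of i j b'] True
      show "(a, b') \<in> insert (i, j) S" by auto
    next
      fix a a' b assume "(a, b) \<in> insert (i, j) S" "(a', b) \<in> D" "a' < a"
      with S_ideal(3)[of a b a'] V_ideal(3)[of i j a'] corner(3)[of a'] True
      show "(a', b) \<in> insert (i, j) S" by auto
    qed
    moreover have "order_ideal (D - insert (i, j) S) (V - {(i, j)})"
    proof (rule order_idealI)
      show "V - {(i, j)} \<subseteq> D - insert (i, j) S" using V_ideal(1) by blast
    next
      fix a b b' assume "(a, b) \<in> V - {(i, j)}" "(a, b') \<in> D - insert (i, j) S" "b' < b"
      with V_ideal(2)[of a b b'] show "(a, b') \<in> V - {(i, j)}" by blast
    next
      fix a a' b assume "(a, b) \<in> V - {(i, j)}" "(a', b) \<in> D - insert (i, j) S" "a' < a"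
      with V_ideal(3)[of a b a'] show "(a', b) \<in> V - {(i, j)}" by blast
    qed
    moreover have "inj_on snd (insert (i, j) S)"
    proof -
      have "(a, j) \<notin> S" for a
        using corner(3)[of a] S_ideal(3)[of a j i] V_ideal(1) True False
        by (cases a i rule: linorder_cases) auto
      with S(2) show ?thesis by (auto simp: inj_on_insert)
    qed
    moreover have "inj_on fst (V - {(i, j)})" using V(2) by (rule inj_on_subset) blast
    ultimately show ?thesis using False by (simp add: toggle_def c strip_pairs_def Let_def)
  qed
qed

lemma strip_pairs_disjoint:
  assumes "(S, V) \<in> strip_pairs D"
  shows "S \<inter> V = {}" "S \<subseteq> D" "V \<subseteq> D"
  using assms order_idealD(1) by (fastforce simp: strip_pairs_def)+

lemma toggle_involution:
  assumes "finite D" "(S, V) \<in> strip_pairs D" "S \<union> V \<noteq> {}"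
    and "toggle (S, V) = (S', V')"
  shows "toggle (S', V') = (S, V)" "S' \<union> V' = S \<union> V"
    "card S' + card V' = card S + card V" "(-1::int) ^ card V' = - ((-1) ^ card V)"
proof -
  define c where "c = corner (S \<union> V)"
  note SV = strip_pairs_disjoint[OF assms(2)]
  have fin: "finite S" "finite V" using SV assms(1) by (auto dest: finite_subset)
  then have c: "c \<in> S \<union> V" unfolding c_def using assms(3) by (intro corner) auto
  have "toggle (S', V') = (S, V) \<and> S' \<union> V' = S \<union> V \<and>
    card S' + card V' = card S + card V \<and> (-1::int) ^ card V' = - ((-1) ^ card V)"
  proof (cases "c \<in> S")
    case True
    then have eq: "S' = S - {c}" "V' = insert c V"
      using assms(4) by (auto simp: toggle_def c_def Let_def)
    have un: "S' \<union> V' = S \<union> V" using True by (auto simp: eq)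
    have "c \<notin> V" using True SV by blast
    moreover have "toggle (S', V') = (insert c S', V' - {c})"
      using un by (auto simp: toggle_def c_def[symmetric] eq Let_def)
    moreover have "card S > 0" using True fin by (auto simp: card_gt_0_iff)
    ultimately show ?thesis using True fin un by (auto simp: eq)
  next
    case False
    then have eq: "S' = insert c S" "V' = V - {c}"
      using assms(4) by (auto simp: toggle_def c_def Let_def)
    have cV: "c \<in> V" using c False by blast
    have un: "S' \<union> V' = S \<union> V" using cV by (auto simp: eq)
    have "toggle (S', V') = (S' - {c}, insert c V')"
      using un by (auto simp: toggle_def c_def[symmetric] eq Let_def)
    moreover obtain n where "card V = Suc n" using cV fin by (cases "card V") auto
    ultimately show ?thesis using cV False fin un by (auto simp: eq)
  qed
  then show "toggle (S', V') = (S, V)" "S' \<union> V' = S \<union> V"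
    "card S' + card V' = card S + card V" "(-1::int) ^ card V' = - ((-1) ^ card V)" by auto
qed

text \<open>The toggle pairs off the strip pairs of total size \<open>k\<close>. It keeps the rest
  \<open>D - (S \<union> V)\<close>, hence the factor coming from \<open>w\<close>, and changes the
  size of \<open>V\<close> by one, hence the sign. Positivity of \<open>k\<close> excludes the pair
  of empty strips, which has no corner.\<close>

lemma alternating_sum_chain_count:
  assumes D: "finite D" and k: "0 < k"
  shows "(\<Sum>i\<le>k. (-1) ^ i * chain_count (Hor (k - i) # Ver i # w) D) = 0"
proof -
  define P where "P = {(S, V) \<in> strip_pairs D. card S + card V = k}"
  define f where "f = (\<lambda>(S, V). (-1) ^ card V * chain_count w (D - (S \<union> V)))"
  have "(\<Sum>i\<le>k. (-1) ^ i * chain_count (Hor (k - i) # Ver i # w) D)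
      = (\<Sum>i\<le>k. \<Sum>S\<in>strips (Hor (k - i)) D. \<Sum>V\<in>strips (Ver i) (D - S). f (S, V))"
    by (auto simp: sum_distrib_left f_def Diff_eq Int_assoc intro!: sum.cong)
  also have "\<dots> = (\<Sum>(i, S, V)\<in>(SIGMA i:{..k}. SIGMA S:strips (Hor (k - i)) D. strips (Ver i) (D - S)). f (S, V))"
    by (subst sum.Sigma; (subst sum.Sigma)?)
       (auto simp del: strips.simps intro!: finite_strips finite_SigmaI D)
  also have "\<dots> = sum f P"
    by (rule sum.reindex_bij_witness[where i = "\<lambda>(S, V). (card V, S, V)" and j = "\<lambda>(i, S, V). (S, V)"])
       (auto simp: P_def strip_pairs_def)
  finally have *: "(\<Sum>i\<le>k. (-1) ^ i * chain_count (Hor (k - i) # Ver i # w) D) = sum f P" .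
  have tog: "toggle p \<in> P \<and> toggle (toggle p) = p \<and> f (toggle p) = - f p" if "p \<in> P" for p
  proof -
    obtain S V where p: "p = (S, V)" by fastforce
    obtain S' V' where t: "toggle (S, V) = (S', V')" by fastforce
    have SV: "(S, V) \<in> strip_pairs D" "card S + card V = k" using that p by (auto simp: P_def)
    then have ne: "S \<union> V \<noteq> {}" using k by auto
    show ?thesis
      using toggle_involution[OF D SV(1) ne t] toggle_strip_pairs[OF D SV(1) ne] SV(2)
      by (auto simp: p t P_def f_def)
  qed
  have "sum f P = (\<Sum>p\<in>P. - f p)"
    by (rule sum.reindex_bij_witness[where i = toggle and j = toggle]) (use tog in auto)
  then have "sum f P = 0" by (simp add: sum_negf)
  then show ?thesis unfolding * .
qed

section \<open>Elimination of vertical letters\<close>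

lemma chain_count_Ver_Cons:
  assumes "finite D" "0 < k"
  shows "chain_count (Ver k # w) D = (\<Sum>i<k. - ((-1) ^ (k + i)) * chain_count (Hor (k - i) # Ver i # w) D)"
proof -
  \<comment> \<open>The term i = k of the alternating sum begins with an empty horizontal strip and
    is therefore the count to be isolated.\<close>
  have "chain_count (Hor 0 # Ver k # w) D = chain_count (Ver k # w) D"
    by (subst chain_count.simps) (simp add: strips_0 assms del: strips.simps)
  with alternating_sum_chain_count[OF assms, of w]
  have "(-1) ^ k * chain_count (Ver k # w) D = - (\<Sum>i<k. (-1) ^ i * chain_count (Hor (k - i) # Ver i # w) D)"
    by (simp add: lessThan_Suc_atMost[symmetric] del: strips.simps chain_count.simps)
  \<comment> \<open>A second factor \<open>(-1) ^ k\<close> cancels the sign of the isolated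
    term.\<close>
  then have "(-1) ^ k * ((-1) ^ k * chain_count (Ver k # w) D)
      = (-1) ^ k * - (\<Sum>i<k. (-1) ^ i * chain_count (Hor (k - i) # Ver i # w) D)"
    by (rule arg_cong)
  then show ?thesis
    by (simp add: mult.assoc[symmetric] power_add[symmetric] sum_distrib_left sum_negf
        del: strips.simps chain_count.simps)
qed

text \<open>The relation for a leading \<open>Ver k\<close> holds for every finite set of cells,
  hence for what each chain of type \<open>u\<close> leaves over; summation over these chains
  preserves a linear relation.\<close>

lemma chain_count_Ver_append:
  assumes "finite D" "0 < k"
  shows "chain_count (u @ Ver k # w) D
       = (\<Sum>i<k. - ((-1) ^ (k + i)) * chain_count (u @ Hor (k - i) # Ver i # w) D)"
  using assms(1)
proof (induction u arbitrary: D)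
  case Nil
  then show ?case using chain_count_Ver_Cons[OF Nil assms(2)] by simp
next
  case (Cons x u)
  have "chain_count ((x # u) @ Ver k # w) D
      = (\<Sum>S\<in>strips x D. \<Sum>i<k. - ((-1) ^ (k + i)) * chain_count (u @ Hor (k - i) # Ver i # w) (D - S))"
    using Cons by simp
  also have "\<dots> = (\<Sum>i<k. - ((-1) ^ (k + i)) * chain_count ((x # u) @ Hor (k - i) # Ver i # w) D)"
    by (subst sum.swap) (simp add: sum_distrib_left)
  finally show ?case .
qed

lemma chain_count_Ver_0_append:
  assumes "finite D"
  shows "chain_count (u @ Ver 0 # w) D = chain_count (u @ w) D"
  using assms
  by (induction u arbitrary: D) (simp_all add: strips_0 del: strips.simps)

text \<open>Termination measure for replacing \<open>Ver k\<close> by terms with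
  \<open>Hor (k - i)\<close> and \<open>Ver i\<close>, where i < k. Counting \<open>Suc k\<close>
  instead of k makes the deletion of \<open>Ver 0\<close> a decrease as well.\<close>

definition ver_weight :: "letter list \<Rightarrow> nat" where
  "ver_weight w = (\<Sum>x\<leftarrow>w. case x of Hor _ \<Rightarrow> 0 | Ver k \<Rightarrow> Suc k)"

lemma chain_count_determined_by_Hor:
  assumes "finite D" "finite D'" and "\<And>as. chain_count (map Hor as) D = chain_count (map Hor as) D'"
  shows "chain_count w D = chain_count w D'"
proof (induction "ver_weight w" arbitrary: w rule: less_induct)
  case less
  show ?case
  proof (cases "\<exists>k. Ver k \<in> set w")
    case False
    then have "\<exists>as. w = map Hor as"
    proof (induction w)
      case (Cons x w)
      then obtain as where "w = map Hor as" by auto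
      moreover obtain a where "x = Hor a" using Cons.prems by (cases x) auto
      ultimately have "x # w = map Hor (a # as)" by simp
      then show ?case ..
    qed simp
    then show ?thesis using assms(3) by auto
  next
    case True
    then obtain k u v where w: "w = u @ Ver k # v" by (meson split_list)
    show ?thesis
    proof (cases "k = 0")
      case True
      have "ver_weight (u @ v) < ver_weight w" by (simp add: w True ver_weight_def)
      with less show ?thesis by (simp add: w True chain_count_Ver_0_append assms)
    next
      case False
      have "chain_count (u @ Hor (k - i) # Ver i # v) D = chain_count (u @ Hor (k - i) # Ver i # v) D'"
        if "i < k" for i
        by (rule less) (use that in \<open>simp add: w ver_weight_def\<close>)
      then show ?thesis
        unfolding w using False by (simp add: chain_count_Ver_append assms)
    qed
  qed
qed

section \<open>Fillings as chains of horizontal strips\<close>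

text \<open>Entries of fillings start at 1, so the multiplicity of the value v sits at list position
  v - 1. The value 0 occurs in no cell, whence its multiplicity 0.\<close>

definition content :: "nat list \<Rightarrow> nat \<Rightarrow> nat" where
  "content as v = (if 0 < v \<and> v \<le> length as then as ! (v - 1) else 0)"

lemma content_simps [simp]:
  "content as 0 = 0" "content (a # as) (Suc 0) = a"
  "content (a # as) (Suc (Suc v)) = content as (Suc v)" "content [] v = 0"
  by (auto simp: content_def)

definition fillings :: "cell set \<Rightarrow> nat list \<Rightarrow> (cell \<Rightarrow> nat) set" where
  "fillings D as = {T. column_strict_filling D T \<and> (\<forall>v. card {c \<in> D. T c = v} = content as v)}"

lemma column_strict_fillingD:
  assumes "column_strict_filling D T"
  shows "c \<in> D \<Longrightarrow> 1 \<le> T c" "c \<notin> D \<Longrightarrow> T c = 0"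
    "(i, j) \<in> D \<Longrightarrow> (i, j') \<in> D \<Longrightarrow> j < j' \<Longrightarrow> T (i, j) \<le> T (i, j')"
    "(i, j) \<in> D \<Longrightarrow> (i', j) \<in> D \<Longrightarrow> i < i' \<Longrightarrow> T (i, j) < T (i', j)"
  using assms unfolding column_strict_filling_def by blast+

lemma finite_fillings_content:
  assumes "finite D"
  shows "finite (fillings D as)"
proof (rule finite_subset)
  show "finite {T. \<forall>c. (c \<in> D \<longrightarrow> T c \<in> {..length as}) \<and> (c \<notin> D \<longrightarrow> T c = 0)}"
    by (rule finite_set_of_finite_funs) (use assms in auto)
  have "T c \<le> length as" if T: "T \<in> fillings D as" and c: "c \<in> D" for T c
  proof (rule ccontr)
    assume "\<not> T c \<le> length as"
    then have "card {d \<in> D. T d = T c} = 0"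
      using T by (simp add: fillings_def content_def)
    with c assms show False by (cases c) auto
  qed
  then show "fillings D as \<subseteq> {T. \<forall>c. (c \<in> D \<longrightarrow> T c \<in> {..length as}) \<and> (c \<notin> D \<longrightarrow> T c = 0)}"
    by (auto simp: fillings_def column_strict_fillingD(2))
qed

lemma filling_remove_first_strip:
  assumes "T \<in> fillings D (a # as)"
  shows "{c. T c = 1} \<in> strips (Hor a) D" "(\<lambda>c. T c - 1) \<in> fillings (D - {c. T c = 1}) as"
proof -
  define S where "S = {c. T c = 1}"
  from assms have T: "column_strict_filling D T"
    and count: "\<And>v. card {c \<in> D. T c = v} = content (a # as) v"
    by (auto simp: fillings_def)
  note csf = column_strict_fillingD[OF T]
  have SD: "S \<subseteq> D" using csf(2) by (force simp: S_def)
  have "order_ideal D S"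
  proof (rule order_idealI[OF SD])
    fix i j j' assume "(i, j) \<in> S" "(i, j') \<in> D" "j' < j"
    with csf(1)[of "(i, j')"] csf(3)[of i j' j] SD show "(i, j') \<in> S" by (auto simp: S_def)
  next
    fix i i' j assume "(i, j) \<in> S" "(i', j) \<in> D" "i' < i"
    with csf(1)[of "(i', j)"] csf(4)[of i' j i] SD show "(i', j) \<in> S" by (auto simp: S_def)
  qed
  moreover have "inj_on snd S"
  proof (rule inj_onI)
    fix c d assume "c \<in> S" "d \<in> S" "snd c = snd d"
    then show "c = d"
      using csf(4)[of "fst c" "snd c" "fst d"] csf(4)[of "fst d" "snd c" "fst c"] SD
      by (cases c; cases d; cases "fst c" "fst d" rule: linorder_cases) (auto simp: S_def)
  qed
  moreover have "{c \<in> D. T c = 1} = S" using SD by (auto simp: S_def)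
  then have "card S = a" using count[of 1] by simp
  ultimately show "{c. T c = 1} \<in> strips (Hor a) D" by (simp add: S_def)
  have gt1: "1 < T c" if "c \<in> D - S" for c
    using that csf(1)[of c] by (auto simp: S_def)
  have "column_strict_filling (D - S) (\<lambda>c. T c - 1)"
    unfolding column_strict_filling_def
  proof (intro conjI allI impI ballI)
    fix c assume "c \<in> D - S" then show "1 \<le> T c - 1" using gt1[of c] by linarith
  next
    \<comment> \<open>Outside \<open>D\<close> the filling is 0 and on \<open>S\<close> it is 1;
      truncated subtraction sends both to the default value 0.\<close>
    fix c assume "c \<notin> D - S" then show "T c - 1 = 0" using csf(2)[of c] by (auto simp: S_def)
  next
    fix i j j' assume "(i, j) \<in> D - S" "(i, j') \<in> D - S" "j < j'"
    then show "T (i, j) - 1 \<le> T (i, j') - 1" using csf(3)[of i j j'] by force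
  next
    fix i i' j assume "(i, j) \<in> D - S" "(i', j) \<in> D - S" "i < i'"
    then show "T (i, j) - 1 < T (i', j) - 1" using csf(4)[of i j i'] gt1[of "(i, j)"] by force
  qed
  moreover have "card {c \<in> D - S. T c - 1 = v} = content as v" for v
  proof (cases v)
    case 0
    then have "{c \<in> D - S. T c - 1 = v} = {}" using gt1 by force
    then show ?thesis by (simp only: 0) simp
  next
    case (Suc u)
    then have "{c \<in> D - S. T c - 1 = v} = {c \<in> D. T c = Suc (Suc u)}"
      using gt1 by (force simp: S_def)
    then show ?thesis using count[of "Suc (Suc u)"] Suc by simp
  qed
  ultimately show "(\<lambda>c. T c - 1) \<in> fillings (D - {c. T c = 1}) as"
    by (simp add: fillings_def S_def)
qed

text \<open>This inverts the removal of the ones: \<open>T\<close> vanishes on \<open>S\<close> and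
  is positive on the rest of \<open>D\<close>, so after the shift the value 1 is taken exactly on
  \<open>S\<close>.\<close>

lemma filling_add_first_strip:
  assumes "S \<in> strips (Hor a) D" "T \<in> fillings (D - S) as"
  shows "(\<lambda>c. if c \<in> D then Suc (T c) else 0) \<in> fillings D (a # as)"
proof -
  define T' where "T' = (\<lambda>c. if c \<in> D then Suc (T c) else 0)"
  from assms have S: "order_ideal D S" "inj_on snd S" "card S = a"
    and T: "column_strict_filling (D - S) T"
    and count: "\<And>v. card {c \<in> D - S. T c = v} = content as v"
    by (auto simp: fillings_def)
  note ideal = order_idealD[OF S(1)]
  note csf = column_strict_fillingD[OF T]
  have T_S: "T c = 0" if "c \<in> S" for c using that csf(2) by blast
  have "column_strict_filling D T'"
    unfolding column_strict_filling_def
  proof (intro conjI allI impI ballI)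
    fix i j j' assume "(i, j) \<in> D" "(i, j') \<in> D" "j < j'"
    then show "T' (i, j) \<le> T' (i, j')"
      using csf(3)[of i j j'] ideal(2)[of i j' j] T_S[of "(i, j)"]
      by (cases "(i, j) \<in> S") (auto simp: T'_def)
  next
    fix i i' j assume ij: "(i, j) \<in> D" "(i', j) \<in> D" "i < i'"
    \<comment> \<open>Otherwise the ideal property would put the higher cell (i, j) into
      \<open>S\<close> too, giving two cells of a horizontal strip in one column.\<close>
    then have "(i', j) \<notin> S"
      using ideal(3)[of i' j i] inj_onD[OF S(2), of "(i, j)" "(i', j)"] by auto
    with ij show "T' (i, j) < T' (i', j)"
      using csf(4)[of i j i'] csf(1)[of "(i', j)"] T_S[of "(i, j)"]
      by (cases "(i, j) \<in> S") (auto simp: T'_def)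
  qed (auto simp: T'_def)
  moreover have "card {c \<in> D. T' c = v} = content (a # as) v" for v
  proof (cases v)
    case 0
    then have "{c \<in> D. T' c = v} = {}" by (auto simp: T'_def)
    then show ?thesis by (simp only: 0) simp
  next
    case (Suc u)
    show ?thesis
    proof (cases u)
      case 0
      have "{c \<in> D. T' c = v} = S"
        using ideal(1) T_S csf(1) by (force simp: T'_def Suc 0)
      then show ?thesis using S(3) by (simp add: Suc 0)
    next
      case (Suc u')
      have "{c \<in> D. T' c = v} = {c \<in> D - S. T c = u}"
        using T_S by (auto simp: T'_def \<open>v = Suc u\<close> Suc)
      then show ?thesis using count[of u] by (simp add: \<open>v = Suc u\<close> Suc)
    qed
  qed
  ultimately show ?thesis by (simp add: fillings_def T'_def)
qed

text \<open>A filling splits into its set of ones and, after lowering the other entries by 1, a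
  filling of the remaining cells. Iterated, the cells with entry v form the v-th strip of a
  chain.\<close>

lemma card_fillings:
  assumes "finite D"
  shows "int (card (fillings D as)) = chain_count (map Hor as) D"
  using assms
proof (induction as arbitrary: D)
  case Nil
  show ?case
  proof (cases "D = {}")
    case True
    then have "fillings D [] = {\<lambda>_. 0}"
      by (auto simp: fillings_def column_strict_filling_def)
    with True show ?thesis by simp
  next
    case False
    then obtain c where c: "c \<in> D" by blast
    have "False" if "T \<in> fillings D []" for T
    proof -
      have "card {d \<in> D. T d = T c} = 0" using that by (simp add: fillings_def)
      with c Nil show False by (cases c) auto
    qed
    then have "fillings D [] = {}" by blast
    with False show ?thesis by simp
  qed
next
  case (Cons a as)
  have "bij_betw (\<lambda>T. ({c. T c = 1}, \<lambda>c. T c - 1)) (fillings D (a # as))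
          (SIGMA S:strips (Hor a) D. fillings (D - S) as)"
  proof (rule bij_betw_byWitness[where f' = "\<lambda>(S, T) c. if c \<in> D then Suc (T c) else 0"])
    show "\<forall>T\<in>fillings D (a # as).
        (case ({c. T c = 1}, \<lambda>c. T c - 1) of (S, T) \<Rightarrow> \<lambda>c. if c \<in> D then Suc (T c) else 0) = T"
    proof
      fix T assume "T \<in> fillings D (a # as)"
      then have "column_strict_filling D T" by (simp add: fillings_def)
      from column_strict_fillingD(1,2)[OF this] show "(case ({c. T c = 1}, \<lambda>c. T c - 1) of (S, T) \<Rightarrow>
          \<lambda>c. if c \<in> D then Suc (T c) else 0) = T"
        by (force simp: fun_eq_iff)
    qed
    show "\<forall>p\<in>SIGMA S:strips (Hor a) D. fillings (D - S) as.
        (\<lambda>T. ({c. T c = 1}, \<lambda>c. T c - 1))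
          (case p of (S, T) \<Rightarrow> \<lambda>c. if c \<in> D then Suc (T c) else 0) = p"
    proof
      fix p assume "p \<in> (SIGMA S:strips (Hor a) D. fillings (D - S) as)"
      then obtain S T where p: "p = (S, T)" and S: "S \<in> strips (Hor a) D"
        and "T \<in> fillings (D - S) as"
        by blast
      then have "column_strict_filling (D - S) T" by (simp add: fillings_def)
      note csf = column_strict_fillingD(1,2)[OF this]
      have "(if c \<in> D then Suc (T c) else 0) = 1 \<longleftrightarrow> c \<in> S" for c
        using strips_subset[OF S] csf(1)[of c] csf(2)[of c] by (cases "c \<in> S") auto
      then have "{c. (if c \<in> D then Suc (T c) else 0) = 1} = S" by blast
      moreover have "(\<lambda>c. (if c \<in> D then Suc (T c) else 0) - 1) = T"
        using csf by (auto simp: fun_eq_iff)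
      ultimately show "(\<lambda>T. ({c. T c = 1}, \<lambda>c. T c - 1))
          (case p of (S, T) \<Rightarrow> \<lambda>c. if c \<in> D then Suc (T c) else 0) = p"
        by (simp add: p)
    qed
  qed (use filling_remove_first_strip filling_add_first_strip in \<open>auto simp del: strips.simps\<close>)
  then have "card (fillings D (a # as)) = card (SIGMA S:strips (Hor a) D. fillings (D - S) as)"
    by (rule bij_betw_same_card)
  also have "\<dots> = (\<Sum>S\<in>strips (Hor a) D. card (fillings (D - S) as))"
    using Cons.prems by (simp add: finite_strips finite_fillings_content del: strips.simps)
  finally show ?case using Cons by simp
qed

section \<open>From coefficients of the skew Schur function to chain counts\<close>

lemma lookup_filling_monomial:
  assumes "finite D"
  shows "Poly_Mapping.lookup (filling_monomial D T) v = card {c \<in> D. T c = v}"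
  using assms
  by (simp add: filling_monomial_def Poly_Mapping.lookup_sum Poly_Mapping.lookup_single when_def
      sum.If_cases Int_def)

definition content_monomial :: "nat list \<Rightarrow> (nat \<Rightarrow>\<^sub>0 nat)" where
  "content_monomial as = (\<Sum>u<length as. Poly_Mapping.single (Suc u) (as ! u))"

lemma lookup_content_monomial:
  "Poly_Mapping.lookup (content_monomial as) v = content as v"
proof (cases v)
  case (Suc u)
  then show ?thesis
    by (simp add: content_monomial_def content_def Poly_Mapping.lookup_sum
        Poly_Mapping.lookup_single when_def Suc_le_eq)
qed (simp add: content_monomial_def Poly_Mapping.lookup_sum Poly_Mapping.lookup_single when_def)

lemma skew_schur_eq_chain_count:
  assumes "finite D"
  shows "skew_schur D (content_monomial as) = chain_count (map Hor as) D"
proof -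
  have "{T. column_strict_filling D T \<and> filling_monomial D T = content_monomial as} = fillings D as"
    by (auto simp: fillings_def poly_mapping_eq_iff fun_eq_iff lookup_content_monomial
        lookup_filling_monomial assms)
  then show ?thesis using card_fillings[OF assms, of as] by (simp add: skew_schur_def)
qed

section \<open>Removing maximal strips\<close>

text \<open>Closure under intervals of the componentwise order is what the trimming argument uses of
  a skew diagram. Unlike a presentation by two partitions, it passes directly to intersections with
  translates, which is what repeated trimming produces.\<close>

definition convex_cells :: "cell set \<Rightarrow> bool" where
  "convex_cells D \<longleftrightarrow> (\<forall>i j i' j' a b. (i, j) \<in> D \<longrightarrow> (i', j') \<in> D \<longrightarrow>
     i \<le> a \<longrightarrow> a \<le> i' \<longrightarrow> j \<le> b \<longrightarrow> b \<le> j' \<longrightarrow> (a, b) \<in> D)"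

lemma convex_cellsD:
  "convex_cells D \<Longrightarrow> (i, j) \<in> D \<Longrightarrow> (i', j') \<in> D \<Longrightarrow>
     i \<le> a \<Longrightarrow> a \<le> i' \<Longrightarrow> j \<le> b \<Longrightarrow> b \<le> j' \<Longrightarrow> (a, b) \<in> D"
  unfolding convex_cells_def by blast

text \<open>Partition diagrams are closed under moving up and left. A cell between two cells of
  \<open>D\<close> thus lies in \<open>lam\<close> because of the lower right one, and if it lay in
  \<open>mu\<close>, so would the upper left one.\<close>

lemma skew_diagram_convex:
  assumes "skew_diagram D"
  shows "convex_cells D"
proof -
  from assms obtain lam mu where lam: "is_partition lam" and mu: "is_partition mu"
    and D: "D = diagram lam - diagram mu"
    by (auto simp: skew_diagram_def)
  have lower: "(a, b) \<in> diagram xs"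
    if "is_partition xs" "(i, j) \<in> diagram xs" "a \<le> i" "b \<le> j" for xs a b i j
  proof -
    have "xs ! i \<le> xs ! a"
      using that sorted_wrt_nth_less[of "(\<ge>)" xs a i]
      by (cases "a = i") (auto simp: is_partition_def diagram_def)
    with that show ?thesis by (auto simp: diagram_def)
  qed
  show ?thesis
    unfolding convex_cells_def D using lower[OF lam] lower[OF mu] by blast
qed

definition trim_top :: "cell set \<Rightarrow> cell set" where
  "trim_top D = {(i, j) \<in> D. \<exists>i'<i. (i', j) \<in> D}"

definition trim_left :: "cell set \<Rightarrow> cell set" where
  "trim_left D = {(i, j) \<in> D. \<exists>j'<j. (i, j') \<in> D}"

lemma inj_on_eqI:
  assumes "inj_on f S" "A \<subseteq> S" "f ` S \<subseteq> f ` A"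
  shows "S = A"
  using assms by (metis inj_on_image_eq_iff image_mono subset_antisym order_refl)

text \<open>A horizontal strip with as many cells as there are nonempty columns meets each of them
  exactly once, and an ideal meeting a column contains its top cell. Hence it consists of the top
  cells; convexity ensures that these do form an ideal.\<close>

lemma strips_Hor_max:
  assumes D: "finite D" "convex_cells D"
  shows "strips (Hor (card (snd ` D))) D = {D - trim_top D}"
proof -
  define A where "A = D - trim_top D"
  have AD: "A \<subseteq> D" by (auto simp: A_def)
  have A_min: "i \<le> i'" if "(i, j) \<in> A" "(i', j) \<in> D" for i i' j
    using that by (auto simp: A_def trim_top_def not_less)
  have A_col: "\<exists>i'\<le>i. (i', j) \<in> A" if "(i, j) \<in> D" for i j
  proof -
    define m where "m = (LEAST m. (m, j) \<in> D)"
    have "(m, j) \<in> D" "m \<le> i" unfolding m_def using that by (auto intro: LeastI Least_le)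
    moreover have "\<not> i' < m" if "(i', j) \<in> D" for i'
      using that unfolding m_def by (auto dest: not_less_Least)
    ultimately show ?thesis by (auto simp: A_def trim_top_def)
  qed
  have img: "snd ` A = snd ` D" using A_col AD by force
  have inj: "inj_on snd A"
  proof (rule inj_onI)
    fix c d assume "c \<in> A" "d \<in> A" "snd c = snd d"
    then show "c = d"
      using A_min[of "fst c" "snd c" "fst d"] A_min[of "fst d" "snd c" "fst c"]
        subsetD[OF AD, of c] subsetD[OF AD, of d]
      by (cases c; cases d) auto
  qed
  have "order_ideal D A"
  proof (rule order_idealI[OF AD])
    fix i j j' assume ij: "(i, j) \<in> A" "(i, j') \<in> D" "j' < j"
    have "i \<le> i'" if "(i', j') \<in> D" for i'
    proof (rule ccontr)
      assume "\<not> i \<le> i'"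
      \<comment> \<open>The rectangle with opposite corners (i', j') and (i, j) lies in
        \<open>D\<close>, so the column of the top cell (i, j) would reach higher up.\<close>
      then have "(i', j) \<in> D"
        using convex_cellsD[OF D(2) that, of i j i' j] ij AD by auto
      with A_min[OF ij(1)] \<open>\<not> i \<le> i'\<close> show False by blast
    qed
    with ij(2) show "(i, j') \<in> A" by (auto simp: A_def trim_top_def not_less)
  next
    fix i i' j assume "(i, j) \<in> A" "(i', j) \<in> D" "i' < i"
    with A_min[of i j i'] show "(i', j) \<in> A" by simp
  qed
  with inj img card_image[OF inj] have "A \<in> strips (Hor (card (snd ` D))) D" by simp
  moreover have "S = A" if "S \<in> strips (Hor (card (snd ` D))) D" for S
  proof (rule inj_on_eqI)
    from that have S: "order_ideal D S" "inj_on snd S" "card S = card (snd ` D)" by auto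
    show "inj_on snd S" by fact
    have SD: "S \<subseteq> D" by (rule order_idealD(1)[OF S(1)])
    then have eq: "snd ` S = snd ` D"
      using S(3) card_image[OF S(2)] D(1) by (intro card_subset_eq) auto
    then show "snd ` S \<subseteq> snd ` A" using img by simp
    show "A \<subseteq> S"
    proof
      fix c assume "c \<in> A"
      then obtain i j where c: "c = (i, j)" "(i, j) \<in> A" by (cases c) auto
      then have "j \<in> snd ` S" using AD eq by force
      then obtain i' where i': "(i', j) \<in> S" by auto
      with A_min[OF c(2), of i'] subsetD[OF SD i'] order_idealD(3)[OF S(1) i', of i]
        subsetD[OF AD c(2)] i' c(1)
      show "c \<in> S" by (cases "i = i'") auto
    qed
  qed
  ultimately show ?thesis unfolding A_def by blast
qed

text \<open>The transposed argument of \<open>strips_Hor_max\<close>, with the leftmost cells of the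
  rows.\<close>

lemma strips_Ver_max:
  assumes D: "finite D" "convex_cells D"
  shows "strips (Ver (card (fst ` D))) D = {D - trim_left D}"
proof -
  define A where "A = D - trim_left D"
  have AD: "A \<subseteq> D" by (auto simp: A_def)
  have A_min: "j \<le> j'" if "(i, j) \<in> A" "(i, j') \<in> D" for i j j'
    using that by (auto simp: A_def trim_left_def not_less)
  have A_row: "\<exists>j'\<le>j. (i, j') \<in> A" if "(i, j) \<in> D" for i j
  proof -
    define m where "m = (LEAST m. (i, m) \<in> D)"
    have "(i, m) \<in> D" "m \<le> j" unfolding m_def using that by (auto intro: LeastI Least_le)
    moreover have "\<not> j' < m" if "(i, j') \<in> D" for j'
      using that unfolding m_def by (auto dest: not_less_Least)
    ultimately show ?thesis by (auto simp: A_def trim_left_def)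
  qed
  have img: "fst ` A = fst ` D" using A_row AD by force
  have inj: "inj_on fst A"
  proof (rule inj_onI)
    fix c d assume "c \<in> A" "d \<in> A" "fst c = fst d"
    then show "c = d"
      using A_min[of "fst c" "snd c" "snd d"] A_min[of "fst c" "snd d" "snd c"]
        subsetD[OF AD, of c] subsetD[OF AD, of d]
      by (cases c; cases d) auto
  qed
  have "order_ideal D A"
  proof (rule order_idealI[OF AD])
    fix i i' j assume ij: "(i, j) \<in> A" "(i', j) \<in> D" "i' < i"
    have "j \<le> j'" if "(i', j') \<in> D" for j'
    proof (rule ccontr)
      assume "\<not> j \<le> j'"
      then have "(i, j') \<in> D"
        using convex_cellsD[OF D(2) that, of i j i j'] ij AD by auto
      with A_min[OF ij(1)] \<open>\<not> j \<le> j'\<close> show False by blast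
    qed
    with ij(2) show "(i', j) \<in> A" by (auto simp: A_def trim_left_def not_less)
  next
    fix i j j' assume "(i, j) \<in> A" "(i, j') \<in> D" "j' < j"
    with A_min[of i j j'] show "(i, j') \<in> A" by simp
  qed
  with inj img card_image[OF inj] have "A \<in> strips (Ver (card (fst ` D))) D" by simp
  moreover have "S = A" if "S \<in> strips (Ver (card (fst ` D))) D" for S
  proof (rule inj_on_eqI)
    from that have S: "order_ideal D S" "inj_on fst S" "card S = card (fst ` D)" by auto
    show "inj_on fst S" by fact
    have SD: "S \<subseteq> D" by (rule order_idealD(1)[OF S(1)])
    then have eq: "fst ` S = fst ` D"
      using S(3) card_image[OF S(2)] D(1) by (intro card_subset_eq) auto
    then show "fst ` S \<subseteq> fst ` A" using img by simp
    show "A \<subseteq> S"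
    proof
      fix c assume "c \<in> A"
      then obtain i j where c: "c = (i, j)" "(i, j) \<in> A" by (cases c) auto
      then have "i \<in> fst ` S" using AD eq by force
      then obtain j' where j': "(i, j') \<in> S" by auto
      with A_min[OF c(2), of j'] subsetD[OF SD j'] order_idealD(2)[OF S(1) j', of j]
        subsetD[OF AD c(2)] j' c(1)
      show "c \<in> S" by (cases "j = j'") auto
    qed
  qed
  ultimately show ?thesis unfolding A_def by blast
qed

lemma chain_count_trim:
  assumes "finite D" "convex_cells D"
  shows "chain_count (Hor (card (snd ` D)) # w) D = chain_count w (trim_top D)"
    and "chain_count (Ver (card (fst ` D)) # w) D = chain_count w (trim_left D)"
proof -
  have "D - (D - trim_top D) = trim_top D" "D - (D - trim_left D) = trim_left D"
    by (auto simp: trim_top_def trim_left_def)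
  then show "chain_count (Hor (card (snd ` D)) # w) D = chain_count w (trim_top D)"
    and "chain_count (Ver (card (fst ` D)) # w) D = chain_count w (trim_left D)"
    by (simp_all add: strips_Hor_max strips_Ver_max assms del: strips.simps)
qed

text \<open>All words are compared, not only horizontal ones: removing the maximal vertical strip is
  read off from words that begin with a \<open>Ver\<close> letter. In this form the relation
  survives both kinds of trimming.\<close>

definition chain_equiv :: "cell set \<Rightarrow> cell set \<Rightarrow> bool" where
  "chain_equiv D D' \<longleftrightarrow> (\<forall>w. chain_count w D = chain_count w D')"

text \<open>Some word has a positive count on the trimmed set; prefixed with the letter of the
  maximal strip, it has a positive count on \<open>D\<close>, hence on \<open>D'\<close>. So
  \<open>D'\<close> has a strip of that size, and a strip has at most one cell per nonempty column
  (or row).\<close>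

lemma chain_equiv_card_le:
  assumes D: "finite D" "convex_cells D" and D': "finite D'" and eq: "chain_equiv D D'"
  shows "card (snd ` D) \<le> card (snd ` D')" "card (fst ` D) \<le> card (fst ` D')"
proof -
  have fin: "finite (trim_top D)" "finite (trim_left D)"
    by (rule finite_subset[OF _ D(1)], auto simp: trim_top_def trim_left_def)+
  from ex_chain_count_pos[OF fin(1)] obtain w where "0 < chain_count w (trim_top D)" by blast
  then have "0 < chain_count (Hor (card (snd ` D)) # w) D'"
    using eq chain_count_trim(1)[OF D] by (simp add: chain_equiv_def)
  then obtain S where "S \<in> strips (Hor (card (snd ` D))) D'"
    using chain_count_Cons_pos_iff[OF D'] by blast
  then have S: "order_ideal D' S" "inj_on snd S" "card S = card (snd ` D)" by auto
  then have "card (snd ` D) = card (snd ` S)" by (simp add: card_image)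
  also have "\<dots> \<le> card (snd ` D')"
    using D' order_idealD(1)[OF S(1)] by (intro card_mono) auto
  finally show "card (snd ` D) \<le> card (snd ` D')" .
  from ex_chain_count_pos[OF fin(2)] obtain w where "0 < chain_count w (trim_left D)" by blast
  then have "0 < chain_count (Ver (card (fst ` D)) # w) D'"
    using eq chain_count_trim(2)[OF D] by (simp add: chain_equiv_def)
  then obtain S where "S \<in> strips (Ver (card (fst ` D))) D'"
    using chain_count_Cons_pos_iff[OF D'] by blast
  then have S: "order_ideal D' S" "inj_on fst S" "card S = card (fst ` D)" by auto
  then have "card (fst ` D) = card (fst ` S)" by (simp add: card_image)
  also have "\<dots> \<le> card (fst ` D')"
    using D' order_idealD(1)[OF S(1)] by (intro card_mono) auto
  finally show "card (fst ` D) \<le> card (fst ` D')" .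
qed

text \<open>By symmetry the bounds of \<open>chain_equiv_card_le\<close> become equalities. One and
  the same leading letter then removes the unique maximal strip from both sets.\<close>

lemma chain_equiv_trim:
  assumes D: "finite D" "convex_cells D" and D': "finite D'" "convex_cells D'"
    and eq: "chain_equiv D D'"
  shows "card (fst ` D) = card (fst ` D')"
    and "chain_equiv (trim_top D) (trim_top D')" "chain_equiv (trim_left D) (trim_left D')"
proof -
  have eq': "chain_equiv D' D" using eq by (simp add: chain_equiv_def)
  have cards: "card (snd ` D) = card (snd ` D')" "card (fst ` D) = card (fst ` D')"
    using chain_equiv_card_le[OF D D'(1) eq] chain_equiv_card_le[OF D' D(1) eq'] by auto
  then show "card (fst ` D) = card (fst ` D')" by simp
  from eq show "chain_equiv (trim_top D) (trim_top D')" "chain_equiv (trim_left D) (trim_left D')"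
    by (simp_all add: chain_equiv_def chain_count_trim[OF D, symmetric]
        chain_count_trim[OF D', symmetric] cards del: chain_count.simps)
qed

text \<open>The intersection of \<open>D\<close> with its translate by (k, l): the closed form of k
  trims from the top followed by l trims from the left. The bounds on i and j guard the truncated
  subtractions.\<close>

definition inner :: "nat \<Rightarrow> nat \<Rightarrow> cell set \<Rightarrow> cell set" where
  "inner k l D = {(i, j) \<in> D. k \<le> i \<and> l \<le> j \<and> (i - k, j - l) \<in> D}"

lemma finite_inner: "finite D \<Longrightarrow> finite (inner k l D)"
  by (rule finite_subset[of _ D]) (auto simp: inner_def)

lemma convex_inner:
  assumes "convex_cells D"
  shows "convex_cells (inner k l D)"
  unfolding convex_cells_def
proof (intro allI impI)
  fix i j i' j' a b
  assume *: "(i, j) \<in> inner k l D" "(i', j') \<in> inner k l D" "i \<le> a" "a \<le> i'" "j \<le> b" "b \<le> j'"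
  then show "(a, b) \<in> inner k l D"
    using convex_cellsD[OF assms, of i j i' j' a b]
      convex_cellsD[OF assms, of "i - k" "j - l" "i' - k" "j' - l" "a - k" "b - l"]
    by (auto simp: inner_def)
qed

text \<open>If a higher cell of the column is also in \<open>inner k l D\<close>, the translates of
  both cells lie in \<open>D\<close>, and convexity of the column puts the one directly above (i -
  k, j - l) into \<open>D\<close>. Conversely, the rectangle from (i - Suc k, j - l) to (i, j) lies
  in \<open>D\<close>, which makes both (i, j) and (i - 1, j) members of
  \<open>inner k l D\<close>.\<close>

lemma trim_top_inner:
  assumes "convex_cells D"
  shows "trim_top (inner k l D) = inner (Suc k) l D"
proof (intro equalityI subsetI)
  fix c assume "c \<in> trim_top (inner k l D)"
  then obtain i j i' where "c = (i, j)" "i' < i" "(i, j) \<in> inner k l D" "(i', j) \<in> inner k l D"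
    by (auto simp: trim_top_def)
  then show "c \<in> inner (Suc k) l D"
    using convex_cellsD[OF assms, of "i' - k" "j - l" "i - k" "j - l" "i - Suc k" "j - l"]
    by (auto simp: inner_def)
next
  fix c assume "c \<in> inner (Suc k) l D"
  then obtain i j where c: "c = (i, j)" "(i, j) \<in> D" "Suc k \<le> i" "l \<le> j" "(i - Suc k, j - l) \<in> D"
    by (auto simp: inner_def)
  then have "(i - 1, j) \<in> inner k l D" "(i, j) \<in> inner k l D"
    using convex_cellsD[OF assms c(5) c(2), of "i - 1" j]
      convex_cellsD[OF assms c(5) c(2), of "i - k" "j - l"]
    by (auto simp: inner_def)
  moreover have "i - 1 < i" using c by auto
  ultimately show "c \<in> trim_top (inner k l D)" unfolding trim_top_def c(1) by blast
qed

lemma trim_left_inner: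
  assumes "convex_cells D"
  shows "trim_left (inner k l D) = inner k (Suc l) D"
proof (intro equalityI subsetI)
  fix c assume "c \<in> trim_left (inner k l D)"
  then obtain i j j' where "c = (i, j)" "j' < j" "(i, j) \<in> inner k l D" "(i, j') \<in> inner k l D"
    by (auto simp: trim_left_def)
  then show "c \<in> inner k (Suc l) D"
    using convex_cellsD[OF assms, of "i - k" "j' - l" "i - k" "j - l" "i - k" "j - Suc l"]
    by (auto simp: inner_def)
next
  fix c assume "c \<in> inner k (Suc l) D"
  then obtain i j where c: "c = (i, j)" "(i, j) \<in> D" "k \<le> i" "Suc l \<le> j" "(i - k, j - Suc l) \<in> D"
    by (auto simp: inner_def)
  then have "(i, j - 1) \<in> inner k l D" "(i, j) \<in> inner k l D"
    using convex_cellsD[OF assms c(5) c(2), of i "j - 1"]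
      convex_cellsD[OF assms c(5) c(2), of "i - k" "j - l"]
    by (auto simp: inner_def)
  moreover have "j - 1 < j" using c by auto
  ultimately show "c \<in> trim_left (inner k l D)" unfolding trim_left_def c(1) by blast
qed

lemma chain_equiv_inner:
  assumes D: "finite D" "convex_cells D" and D': "finite D'" "convex_cells D'"
    and eq: "chain_equiv D D'"
  shows "chain_equiv (inner k l D) (inner k l D')"
proof (induction l)
  case 0
  show ?case
  proof (induction k)
    case 0
    have "inner 0 0 A = A" for A by (auto simp: inner_def)
    with eq show ?case by simp
  next
    case (Suc k)
    from chain_equiv_trim(2)[OF finite_inner[OF D(1)] convex_inner[OF D(2)]
        finite_inner[OF D'(1)] convex_inner[OF D'(2)] Suc]
    show ?case by (simp add: trim_top_inner D D')
  qed
next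
  case (Suc l)
  from chain_equiv_trim(3)[OF finite_inner[OF D(1)] convex_inner[OF D(2)]
      finite_inner[OF D'(1)] convex_inner[OF D'(2)] Suc]
  show ?case by (simp add: trim_left_inner D D')
qed

lemma card_rows_inner_eq:
  assumes D: "finite D" "convex_cells D" and D': "finite D'" "convex_cells D'"
    and eq: "chain_equiv D D'"
  shows "card (fst ` inner k l D) = card (fst ` inner k l D')"
  by (rule chain_equiv_trim(1)[OF finite_inner[OF D(1)] convex_inner[OF D(2)]
        finite_inner[OF D'(1)] convex_inner[OF D'(2)] chain_equiv_inner[OF assms]])

section \<open>Row overlaps\<close>

lemma sorted_wrt_less_nth_add_le:
  fixes rs :: "nat list"
  assumes "sorted_wrt (<) rs" "p + m < length rs"
  shows "rs ! p + m \<le> rs ! (p + m)"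
  using assms(2)
proof (induction m)
  case (Suc m)
  then show ?case
    using sorted_wrt_nth_less[OF assms(1), of "p + m" "p + Suc m"] by simp
qed simp

text \<open>Overlaps address rows by their position among the occupied rows, \<open>inner\<close> by
  their actual number. Where a whole interval of rows is occupied, the increasing list can neither
  skip nor insert a row, so the two numberings differ there by a constant.\<close>

lemma sorted_wrt_less_nth_consecutive:
  fixes rs :: "nat list"
  assumes rs: "sorted_wrt (<) rs" and p: "p < length rs"
    and mem: "\<And>x. rs ! p \<le> x \<Longrightarrow> x \<le> rs ! p + m \<Longrightarrow> x \<in> set rs"
  shows "t \<le> m \<Longrightarrow> p + t < length rs \<and> rs ! (p + t) = rs ! p + t"
proof (induction t)
  case (Suc t)
  then have IH: "p + t < length rs" "rs ! (p + t) = rs ! p + t" by auto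
  from Suc.prems mem[of "rs ! p + Suc t"]
  obtain q where q: "q < length rs" "rs ! q = rs ! p + Suc t" by (auto simp: in_set_conv_nth)
  have "\<not> q \<le> p + t"
  proof
    assume "q \<le> p + t"
    then have "rs ! q \<le> rs ! (p + t)"
      using sorted_wrt_nth_less[OF rs, of q "p + t"] IH by (cases "q = p + t") auto
    with q IH show False by simp
  qed
  then have le: "p + Suc t \<le> q" by simp
  then have "rs ! (p + Suc t) \<le> rs ! q"
    using sorted_wrt_nth_less[OF rs, of "p + Suc t" q] q by (cases "p + Suc t = q") auto
  moreover have "rs ! p + Suc t \<le> rs ! (p + Suc t)"
    using le q by (intro sorted_wrt_less_nth_add_le rs) auto
  ultimately show ?case using q le by auto
qed (use p in simp)

text \<open>A window of m + 1 successive occupied rows is sent to its lowest row i. By convexity,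
  rows with a common column have no gap between them and their common columns form an interval. So n
  + 1 common columns amount to some j with (i, j) and (i - m, j - n) both in
  \<open>D\<close>.\<close>

lemma count_overlaps_ge:
  assumes D: "finite D" "convex_cells D"
  shows "length (filter (\<lambda>a. Suc n \<le> a) (row_overlap_composition (Suc m) D))
       = card (fst ` inner m n D)"
proof -
  define rs where "rs = occupied_rows D"
  define Ov where "Ov p = {c. \<forall>t\<in>{p..<p + Suc m}. (rs ! t, c) \<in> D}" for p
  define A where "A = {p. p + m < length rs \<and> Suc n \<le> card (Ov p)}"
  have rs: "sorted_wrt (<) rs" "set rs = fst ` D"
    using D(1) by (auto simp: rs_def occupied_rows_def)
  have fin: "finite (Ov p)" for p
    by (rule finite_subset[of _ "snd ` D"]) (use D(1) in \<open>force simp: Ov_def\<close>)+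
  have "length (filter (\<lambda>a. Suc n \<le> a) (row_overlap_composition (Suc m) D)) = card A"
  proof -
    have "{p. p < length rs - m \<and> Suc n \<le> card {c. \<forall>t\<in>{p..<p + Suc m}. (rs ! t, c) \<in> D}} = A"
      unfolding A_def Ov_def by auto
    then show ?thesis
      by (simp add: row_overlap_composition_def Let_def rs_def[symmetric]
          length_filter_conv_card cong: conj_cong)
  qed
  also have "card A = card ((\<lambda>p. rs ! (p + m)) ` A)"
  proof (rule card_image[symmetric], rule inj_onI)
    have "distinct rs" using rs(1) strict_sorted_iff by blast
    then show "p = q" if "p \<in> A" "q \<in> A" "rs ! (p + m) = rs ! (q + m)" for p q
      using that by (auto simp: A_def nth_eq_iff_index_eq)
  qed
  also have "(\<lambda>p. rs ! (p + m)) ` A = fst ` inner m n D"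
  proof (intro equalityI subsetI)
    fix i assume "i \<in> (\<lambda>p. rs ! (p + m)) ` A"
    then obtain p where i: "i = rs ! (p + m)" and p: "p + m < length rs" "Suc n \<le> card (Ov p)"
      by (auto simp: A_def)
    then have ne: "Ov p \<noteq> {}" by auto
    \<comment> \<open>At least n + 1 common columns lie between these extremes, so
      \<open>c0 + n \<le> c1\<close>, and (i, c0 + n) will be the cell of \<open>inner m n D\<close>
      in row i.\<close>
    define c0 c1 where "c0 = Min (Ov p)" and "c1 = Max (Ov p)"
    have c: "c0 \<in> Ov p" "c1 \<in> Ov p" unfolding c0_def c1_def using fin ne by auto
    have "Ov p \<subseteq> {c0..c1}" unfolding c0_def c1_def using fin by auto
    then have "card (Ov p) \<le> Suc c1 - c0" using card_mono[of "{c0..c1}" "Ov p"] by simp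
    then have c01: "c0 + n \<le> c1" using p by simp
    have cD: "(rs ! p, c0) \<in> D" "(i, c0) \<in> D" "(i, c1) \<in> D"
      using c by (auto simp: Ov_def i)
    have "rs ! p + m \<le> i" unfolding i using p by (intro sorted_wrt_less_nth_add_le rs)
    \<comment> \<open>Column \<open>c0\<close> meets every row from \<open>rs ! p\<close> down to i,
      so none of these rows is empty.\<close>
    then have "x \<in> set rs" if "rs ! p \<le> x" "x \<le> rs ! p + m" for x
      using convex_cellsD[OF D(2) cD(1,2), of x c0] that unfolding rs(2) by force
    then have "i = rs ! p + m"
      using sorted_wrt_less_nth_consecutive[OF rs(1), of p m m] p i by auto
    moreover have "(i, c0 + n) \<in> D"
      using convex_cellsD[OF D(2) cD(2,3), of i "c0 + n"] c01 by simp
    ultimately have "(i, c0 + n) \<in> inner m n D" using cD by (auto simp: inner_def)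
    then show "i \<in> fst ` inner m n D" by force
  next
    fix i assume "i \<in> fst ` inner m n D"
    then obtain j where ij: "(i, j) \<in> D" "m \<le> i" "n \<le> j" "(i - m, j - n) \<in> D"
      by (auto simp: inner_def)
    have "i - m \<in> set rs" using ij(4) unfolding rs(2) by force
    then obtain p where p: "p < length rs" "rs ! p = i - m" by (auto simp: in_set_conv_nth)
    have "x \<in> set rs" if "rs ! p \<le> x" "x \<le> rs ! p + m" for x
      using convex_cellsD[OF D(2) ij(4,1), of x j] that p ij(2) unfolding rs(2) by force
    then have consec: "p + t < length rs \<and> rs ! (p + t) = rs ! p + t" if "t \<le> m" for t
      using sorted_wrt_less_nth_consecutive[OF rs(1) p(1) _ that] by blast
    \<comment> \<open>The two given cells are opposite corners of a rectangle inside
      \<open>D\<close>, whose n + 1 columns are shared by all its rows.\<close>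
    have "{j - n..j} \<subseteq> Ov p"
    proof
      fix b assume b: "b \<in> {j - n..j}"
      have "(rs ! t, b) \<in> D" if "t \<in> {p..<p + Suc m}" for t
      proof -
        have "rs ! t = i - m + (t - p)" using consec[of "t - p"] that p by auto
        then show ?thesis
          using convex_cellsD[OF D(2) ij(4,1), of "rs ! t" b] b that ij(2) by auto
      qed
      then show "b \<in> Ov p" by (simp add: Ov_def)
    qed
    then have "Suc n \<le> card (Ov p)" using card_mono[OF fin, of "{j - n..j}" p] ij(3) by simp
    then have "p \<in> A" using consec[of m] by (simp add: A_def)
    moreover have "i = rs ! (p + m)" using consec[of m] p ij(2) by simp
    ultimately show "i \<in> (\<lambda>p. rs ! (p + m)) ` A" by blast
  qed
  finally show ?thesis .
qed

section \<open>Recovering a partition from its conjugate\<close>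

lemma length_filter_ge_eq_count:
  "length (filter (\<lambda>a. x \<le> a) xs) = count (mset xs) x + length (filter (\<lambda>a. Suc x \<le> a) xs)"
  by (induction xs) auto

text \<open>The compared numbers are the parts of the conjugate partition. Their successive
  differences are the multiplicities of the positive values, and a sorted list depends only on
  these.\<close>

lemma rev_sort_filter_nonzero_eqI:
  assumes "\<And>n. length (filter (\<lambda>a. Suc n \<le> a) xs) = length (filter (\<lambda>a. Suc n \<le> a) ys)"
  shows "rev (sort (filter (\<lambda>a. a \<noteq> 0) xs)) = rev (sort (filter (\<lambda>a. a \<noteq> 0) ys))"
proof -
  have "count (mset xs) x = count (mset ys) x" if "x \<noteq> 0" for x
  proof -
    from that obtain n where "x = Suc n" by (cases x) auto
    then show ?thesis
      using assms[of n] assms[of "Suc n"] length_filter_ge_eq_count[of x xs]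
        length_filter_ge_eq_count[of x ys] by simp
  qed
  then have "mset (filter (\<lambda>a. a \<noteq> 0) xs) = mset (filter (\<lambda>a. a \<noteq> 0) ys)"
    by (intro multiset_eqI) simp
  then show ?thesis by (metis sorted_list_of_multiset_mset)
qed

lemma skew_equiv_row_overlap_partition:
  assumes "skew_diagram D" "skew_diagram D'" "D \<sim>\<^sub>s D'" "1 \<le> k"
  shows "row_overlap_partition k D = row_overlap_partition k D'"
proof -
  note D = finite_skew_diagram[OF assms(1)] skew_diagram_convex[OF assms(1)]
  note D' = finite_skew_diagram[OF assms(2)] skew_diagram_convex[OF assms(2)]
  have "chain_count (map Hor as) D = chain_count (map Hor as) D'" for as
    using assms(3) skew_schur_eq_chain_count[OF D(1), of as]
      skew_schur_eq_chain_count[OF D'(1), of as] by (simp add: skew_equiv_def)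
  then have eq: "chain_equiv D D'"
    unfolding chain_equiv_def using chain_count_determined_by_Hor D(1) D'(1) by blast
  obtain m where k: "k = Suc m" using assms(4) by (cases k) auto
  show ?thesis
    unfolding row_overlap_partition_def k
    by (rule rev_sort_filter_nonzero_eqI)
       (simp only: count_overlaps_ge[OF D] count_overlaps_ge[OF D'] card_rows_inner_eq[OF D D' eq])
qed

theorem corollary8p11:
  shows "(\<exists>\<Phi> :: ((nat \<Rightarrow>\<^sub>0 nat) \<Rightarrow> int) \<Rightarrow> nat \<Rightarrow> nat list.
            \<forall>D. skew_diagram D \<longrightarrow>
              (\<forall>k \<ge> 1. \<Phi> (skew_schur D) k = row_overlap_partition k D)) \<and>
         (\<forall>D D'. skew_diagram D \<longrightarrow> skew_diagram D' \<longrightarrow> D \<sim>\<^sub>s D' \<longrightarrow>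
            (\<forall>k \<ge> 1. row_overlap_partition k D = row_overlap_partition k D'))"
proof
  \<comment> \<open>Any skew diagram with the given series may be chosen, since the row overlap
    partitions agree for all of them; on series that are not skew Schur functions the value is
    arbitrary.\<close>
  define \<Phi> where "\<Phi> s k = row_overlap_partition k (SOME D. skew_diagram D \<and> skew_schur D = s)"
    for s :: "(nat \<Rightarrow>\<^sub>0 nat) \<Rightarrow> int" and k
  have "\<Phi> (skew_schur D) k = row_overlap_partition k D" if "skew_diagram D" "1 \<le> k" for D k
  proof -
    have "skew_diagram (SOME E. skew_diagram E \<and> skew_schur E = skew_schur D) \<and>
        skew_schur (SOME E. skew_diagram E \<and> skew_schur E = skew_schur D) = skew_schur D"
      by (rule someI[of _ D]) (use that in simp)
    with that show ?thesis
      unfolding \<Phi>_def by (intro skew_equiv_row_overlap_partition) (auto simp: skew_equiv_def)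
  qed
  then show "\<exists>\<Phi> :: ((nat \<Rightarrow>\<^sub>0 nat) \<Rightarrow> int) \<Rightarrow> nat \<Rightarrow> nat list.
      \<forall>D. skew_diagram D \<longrightarrow> (\<forall>k\<ge>1. \<Phi> (skew_schur D) k = row_overlap_partition k D)"
    by blast
qed (use skew_equiv_row_overlap_partition in blast)

end
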